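(* Let $\Omega\subset\mathbb{R}^n$ be a bounded domain. For every $\mu\in\mathcal{P}(\Omega)$, $$J_*^\infty(\mu)=\inf_{\delta\in\mathcal{P}(\partial\Omega)}W^1(\mu,\delta).$$
   Context: $\mathcal{P}(\cdot)$ denotes Borel probability measures; $\mathrm{Lip}(\overline\Omega)$ Lipschitz functions on $\overline\Omega$; $\mathrm{Lip}_0(\Omega)$ those vanishing on $\partial\Omega$; $\|\nabla u\|_{L^\infty}$ the essential supremum of $|\nabla u|$ over $\Omega$. For a finite signed Radon measure $\mu$ on $\Omega$, $J_*^\infty(\mu)=\sup\{\int_\Omega u\,d\mu:u\in\mathrm{Lip}_0(\Omega),\ \|\nabla u\|_{L^\infty}\le1\}$. For $\mu,\delta\in\mathcal{P}(\overline\Omega)$, $W^1(\mu,\delta)=\sup\{\int u\,d\mu-\int u\,d\delta:u\in\mathrm{Lip}(\overline\Omega),\ \|\nabla u\|_{L^\infty}\le1\}$ (integrals over $\overline\Omega$; measures on $\Omega$ or $\partial\Omega$ are regarded as measures on $\overline\Omega$). *)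

theory Defs
  imports "HOL-Analysis.Analysis" "HOL-Probability.Essential_Supremum"
    "HOL-Probability.Probability_Measure"
begin

definition bounded_domain :: "'a::euclidean_space set \<Rightarrow> bool" where
  "bounded_domain \<Omega> \<longleftrightarrow> open \<Omega> \<and> connected \<Omega> \<and> \<Omega> \<noteq> {} \<and> bounded \<Omega>"

definition grad :: "('a::euclidean_space \<Rightarrow> real) \<Rightarrow> 'a \<Rightarrow> 'a" where
  "grad u x = (THE D. GDERIV u x :> D)"

lemma grad_eq: "GDERIV u x :> D \<Longrightarrow> grad u x = D" for u :: "'a::euclidean_space \<Rightarrow> real"
  unfolding grad_def
proof (rule the_equality)
  fix D' assume "GDERIV u x :> D" "GDERIV u x :> D'"
  then have "(\<lambda>h. inner h D') = (\<lambda>h. inner h D)"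
    unfolding gderiv_def by (rule has_derivative_unique[rotated])
  then have "inner (D' - D) D' = inner (D' - D) D" by metis
  then show "D' = D"
    by (metis inner_diff_right inner_eq_zero_iff right_minus_eq)
qed

(* The essential supremum over \<Omega>, with respect to Lebesgue measure, of the Euclidean norm
   of the gradient. By Rademacher's theorem a Lipschitz function is differentiable almost
   everywhere, so the value at points without a gradient is irrelevant for such functions;
   it is set to \<infinity> so that an undefined gradient never counts as a small one.
   The gradient at x \<in> \<Omega> depends on the values of u on \<Omega> only, as \<Omega> is open. *)
definition grad_Linf :: "'a::euclidean_space set \<Rightarrow> ('a \<Rightarrow> real) \<Rightarrow> ereal" where
  "grad_Linf \<Omega> u = esssup (lebesgue_on \<Omega>)
     (\<lambda>x. if \<exists>D. GDERIV u x :> D then ereal (norm (grad u x)) else \<infinity>)"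

(* Functions on the closure of \<Omega> are total functions whose values elsewhere play no role. *)
definition Lip_closure :: "'a::euclidean_space set \<Rightarrow> ('a \<Rightarrow> real) set" where
  "Lip_closure \<Omega> = {u. \<exists>L. L-lipschitz_on (closure \<Omega>) u}"

definition Lip_zero :: "'a::euclidean_space set \<Rightarrow> ('a \<Rightarrow> real) set" where
  "Lip_zero \<Omega> = {u \<in> Lip_closure \<Omega>. \<forall>x\<in>frontier \<Omega>. u x = 0}"

definition borel_probs :: "'a::euclidean_space set \<Rightarrow> 'a measure set" where
  "borel_probs S = {M. prob_space M \<and> sets M = sets (restrict_space borel S)}"

(* A Borel measure on a subset of the closure of \<Omega>, regarded as a measure on the closure:
   the image under the inclusion map. *)
definition on_closure :: "'a::euclidean_space set \<Rightarrow> 'a measure \<Rightarrow> 'a measure" where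
  "on_closure \<Omega> M = distr M (restrict_space borel (closure \<Omega>)) (\<lambda>x. x)"

(* Only positive measures on \<Omega> occur as arguments here, so the measure type of the library
   suffices. *)
definition J_star :: "'a::euclidean_space set \<Rightarrow> 'a measure \<Rightarrow> ereal" where
  "J_star \<Omega> \<mu> = (SUP u \<in> {u \<in> Lip_zero \<Omega>. grad_Linf \<Omega> u \<le> 1}. ereal (\<integral>x. u x \<partial>\<mu>))"

(* Extended-valued: the constraint bounds the slope of u with respect to the path metric of
   \<Omega>, which may be unbounded although \<Omega> is bounded. *)
definition W1 :: "'a::euclidean_space set \<Rightarrow> 'a measure \<Rightarrow> 'a measure \<Rightarrow> ereal" where
  "W1 \<Omega> \<mu> \<delta> = (SUP u \<in> {u \<in> Lip_closure \<Omega>. grad_Linf \<Omega> u \<le> 1}.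
     ereal ((\<integral>x. u x \<partial>\<mu>) - (\<integral>x. u x \<partial>\<delta>)))"

end

theory Submission
  imports Defs
begin

text \<open>
  Both sides of the identity equal \<open>\<integral>x. infdist x (frontier \<Omega>) \<partial>\<mu>\<close>: the cheapest way to move
  \<open>\<mu>\<close> to the boundary sends each point straight to a nearest boundary point.

  The gradient constraint sees only the path metric of \<open>\<Omega>\<close>. But the open ball
  around \<open>x \<in> \<Omega>\<close> whose radius is the distance from \<open>x\<close> to the boundary lies in \<open>\<Omega>\<close>, and on a convex
  set the constraint does give the Euclidean slope bound
  (\<open>lipschitz_on_of_AE_gradient_le\<close>). So an admissible \<open>u\<close> changes by at most the distance between
  \<open>x\<close> and a nearest boundary point. Pushing \<open>\<mu>\<close> forward under a measurable map \<open>P\<close> that almost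
  selects nearest points yields \<open>\<delta>\<close> whose \<open>W1\<close>-distance from \<open>\<mu>\<close> exceeds the integral of the
  distance arbitrarily little (\<open>ex_boundary_prob_W1_le\<close>).

  In the other direction, the distance to the boundary is, up to an arbitrarily small error, a
  competitor for \<open>J_star\<close>. It is not differentiable everywhere; instead of invoking Rademacher's
  theorem, it is approximated from below by \<open>C\<^sup>1\<close> functions with gradient at most \<open>1\<close> that vanish on
  the boundary: a soft minimum of regularised distances to finitely many boundary points, followed
  by a \<open>C\<^sup>1\<close> cutoff (\<open>smooth_approx_infdist\<close>).

  The chain closes with \<open>J_star \<Omega> \<mu> \<le> W1 \<Omega> \<mu> \<delta>\<close> for every \<open>\<delta>\<close> on the boundary, because the
  competitors for \<open>J_star\<close> have integral \<open>0\<close> against \<open>\<delta>\<close>.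
\<close>

section \<open>Lipschitz functions whose gradient is bounded almost everywhere\<close>

lemma gderiv_difference_quotient:
  fixes u :: "'a::euclidean_space \<Rightarrow> real"
  assumes "GDERIV u w :> D"
  shows "(\<lambda>m. real m * (u (w + v /\<^sub>R real m) - u w)) \<longlonglongrightarrow> v \<bullet> D"
proof -
  have "((\<lambda>t. w + t *\<^sub>R v) has_derivative (\<lambda>t. t *\<^sub>R v)) (at 0)"
    by (auto intro!: derivative_eq_intros)
  moreover have "(u has_derivative (\<lambda>h. h \<bullet> D)) (at (w + 0 *\<^sub>R v))"
    using assms by (simp add: gderiv_def)
  ultimately have "((\<lambda>t. u (w + t *\<^sub>R v)) has_derivative (\<lambda>t. (t *\<^sub>R v) \<bullet> D)) (at 0)"
    by (rule has_derivative_compose)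
  then have "DERIV (\<lambda>t. u (w + t *\<^sub>R v)) 0 :> v \<bullet> D"
    by (simp add: has_field_derivative_def mult_commute_abs)
  then have lim: "((\<lambda>t. (u (w + t *\<^sub>R v) - u w) / t) \<longlongrightarrow> v \<bullet> D) (at 0)"
    by (simp add: DERIV_def)
  have "filterlim (\<lambda>m. inverse (real m)) (at 0) sequentially"
    unfolding filterlim_at
    by (auto intro: LIMSEQ_inverse_real_of_nat lim_inverse_n eventually_mono[OF eventually_gt_at_top[of 0]])
  from filterlim_compose[OF lim this] show ?thesis
    by (simp add: field_simps)
qed

text \<open>
  The exceptional null set may contain the whole segment from \<open>x\<close> to \<open>y\<close>, so the increment
  \<open>u (y + z) - u (x + z)\<close> is averaged over \<open>z\<close> in a small ball. Cut the segment into \<open>m\<close> equal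
  steps. The amount by which a step starting at \<open>w\<close> exceeds its allowance \<open>K * norm v / m\<close> is at
  most \<open>g m w / m\<close>, where \<open>g m\<close> is the positive excess of the rescaled difference quotient. At a point
  of differentiability \<open>g m\<close> tends to \<open>0\<close>, and the Lipschitz bound dominates it, so its integral
  tends to \<open>0\<close>; by translation invariance each of the \<open>m\<close> steps contributes at most that integral
  divided by \<open>m\<close>.
\<close>

lemma lipschitz_on_of_AE_gradient_le:
  fixes u :: "'a::euclidean_space \<Rightarrow> real"
  assumes S: "open S" "convex S" "bounded S"
    and L: "L-lipschitz_on S u"
    and K: "K \<ge> 0"
    and AE: "AE w in lborel. w \<in> S \<longrightarrow> (\<exists>D. GDERIV u w :> D \<and> norm D \<le> K)"
  shows "K-lipschitz_on S u"
proof (rule lipschitz_onI[OF _ K])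
  fix x y assume xy: "x \<in> S" "y \<in> S"
  define v where "v = y - x"
  define T where "T m = S \<inter> (\<lambda>w. w + v /\<^sub>R real m) -` S" for m :: nat
  define q where "q m w = max 0 (real m * \<bar>u (w + v /\<^sub>R real m) - u w\<bar> - K * norm v)"
    for m :: nat and w
  define g where "g m w = indicator (T m) w *\<^sub>R q m w" for m :: nat and w
  have L0: "L \<ge> 0"
    using L by (rule lipschitz_on_nonneg)
  have uc: "continuous_on S u"
    using L by (rule lipschitz_on_continuous_on)
  have Topen: "open (T m)" for m
    unfolding T_def using S(1) by (intro open_Int open_vimage continuous_intros)
  have g_meas [measurable]: "g m \<in> borel_measurable borel" for m
  proof -
    have "continuous_on (T m) (q m)"
      unfolding q_def T_def
      by (intro continuous_intros continuous_on_compose2[OF uc] continuous_on_subset[OF uc]) auto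
    then show ?thesis
      unfolding g_def using Topen[of m]
      by (intro borel_measurable_continuous_on_indicator) auto
  qed
  have g_nonneg: "0 \<le> g m w" for m w
    by (simp add: g_def q_def)
  have g_bound: "g m w \<le> indicator S w * (L * norm v)" for m w
  proof (cases "w \<in> T m \<and> m > 0")
    case True
    then have w: "w \<in> S" "w + v /\<^sub>R real m \<in> S"
      by (auto simp: T_def)
    have "\<bar>u (w + v /\<^sub>R real m) - u w\<bar> \<le> L * (norm v / real m)"
      using lipschitz_on_normD[OF L w(2) w(1)] by (simp add: field_simps)
    then have "real m * \<bar>u (w + v /\<^sub>R real m) - u w\<bar> \<le> L * norm v"
      using True by (simp add: field_simps)
    moreover have "0 \<le> L * norm v" "0 \<le> K * norm v"
      using L0 K by simp_all
    ultimately have "q m w \<le> L * norm v"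
      unfolding q_def by (intro max.boundedI; linarith)
    then show ?thesis
      using True w by (simp add: g_def)
  next
    case False
    moreover have "0 \<le> L * norm v" "0 \<le> K * norm v"
      using L0 K by simp_all
    ultimately show ?thesis
      by (auto simp: g_def q_def indicator_def)
  qed
  have dom: "integrable lborel (\<lambda>w. indicator S w * (L * norm v))"
  proof -
    have "emeasure lborel S < \<infinity>"
      using S(3) by (rule emeasure_bounded_finite)
    then show ?thesis
      using S(1) by (intro integrable_mult_left integrable_real_indicator) auto
  qed
  have g_lim: "AE w in lborel. (\<lambda>m. g m w) \<longlonglongrightarrow> 0"
    using AE
  proof eventually_elim
    case (elim w)
    show ?case
    proof (cases "w \<in> S")
      case True
      with elim obtain D where D: "GDERIV u w :> D" "norm D \<le> K"
        by auto
      have "(\<lambda>m. max 0 (\<bar>real m * (u (w + v /\<^sub>R real m) - u w)\<bar> - K * norm v))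
          \<longlonglongrightarrow> max 0 (\<bar>v \<bullet> D\<bar> - K * norm v)"
        by (intro tendsto_intros gderiv_difference_quotient D(1))
      also have "max 0 (\<bar>v \<bullet> D\<bar> - K * norm v) = 0"
        using Cauchy_Schwarz_ineq2[of v D] mult_left_mono[OF D(2) norm_ge_zero[of v]]
        by (simp add: mult.commute)
      finally have "(\<lambda>m. q m w) \<longlonglongrightarrow> 0"
        by (simp add: q_def abs_mult)
      then show ?thesis
        by (rule tendsto_sandwich[OF _ _ tendsto_const, rotated -1])
          (auto simp: g_nonneg, auto simp: g_def q_def indicator_def)
    next
      case False
      then have "g m w = 0" for m
        by (simp add: g_def T_def)
      then show ?thesis
        by simp
    qed
  qed
  have int_lim: "(\<lambda>m. integral\<^sup>L lborel (g m)) \<longlonglongrightarrow> 0"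
    using integral_dominated_convergence[OF _ _ dom g_lim] g_bound g_nonneg
    by (simp add: g_meas[simplified])
  have g_int: "integrable lborel (g m)" for m
    by (rule Bochner_Integration.integrable_bound[OF dom])
      (use g_bound g_nonneg L0 in \<open>auto simp: abs_of_nonneg\<close>)
  \<comment> \<open>Averaging over a ball of radius \<open>r\<close> costs at most \<open>L * r\<close> at each end point.\<close>
  have small: "\<bar>u y - u x\<bar> - 2 * L * r - K * norm v \<le> 0"
    if r: "r > 0" "ball x r \<subseteq> S" "ball y r \<subseteq> S" for r
  proof -
    define c where "c = \<bar>u y - u x\<bar> - 2 * L * r - K * norm v"
    define B where "B = ball (0::'a) r"
    have le: "c * measure lborel B \<le> integral\<^sup>L lborel (g m)" if m: "m > 0" for m
    proof -
      define p where "p k = x + (real k / real m) *\<^sub>R v" for k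
      have pS: "p k + z \<in> S" if "z \<in> B" "k \<le> m" for k z
      proof -
        have "x + z \<in> S" "y + z \<in> S"
          using that r by (auto simp: B_def dist_norm subset_iff)
        then have "(1 - real k / real m) *\<^sub>R (x + z) + (real k / real m) *\<^sub>R (y + z) \<in> S"
          using that m by (intro convexD[OF S(2)]) (auto simp: field_simps)
        then show ?thesis
          by (simp add: p_def v_def algebra_simps)
      qed
      have p_Suc: "p (Suc k) + z = (p k + z) + v /\<^sub>R real m" for k z
        using m by (simp add: p_def algebra_simps add_divide_distrib divide_inverse)
      have key: "c \<le> (\<Sum>k<m. g m (p k + z)) / real m" if z: "z \<in> B" for z
      proof -
        have step: "\<bar>u (p (Suc k) + z) - u (p k + z)\<bar> \<le> (K * norm v + g m (p k + z)) / real m"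
          if k: "k < m" for k
        proof -
          have "p k + z \<in> T m"
            using pS[OF z, of k] pS[OF z, of "Suc k"] k by (simp add: T_def p_Suc)
          then have "real m * \<bar>u (p (Suc k) + z) - u (p k + z)\<bar> \<le> K * norm v + g m (p k + z)"
            by (simp add: g_def q_def p_Suc)
          then show ?thesis
            using m by (simp add: field_simps)
        qed
        have "u (p m + z) - u (p 0 + z) = (\<Sum>k<m. u (p (Suc k) + z) - u (p k + z))"
          by (rule sum_lessThan_telescope[symmetric])
        then have "\<bar>u (p m + z) - u (p 0 + z)\<bar> \<le> (\<Sum>k<m. \<bar>u (p (Suc k) + z) - u (p k + z)\<bar>)"
          by simp
        also have "\<dots> \<le> (\<Sum>k<m. (K * norm v + g m (p k + z)) / real m)"
          using step by (intro sum_mono) auto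
        also have "\<dots> = K * norm v + (\<Sum>k<m. g m (p k + z)) / real m"
          using m by (simp add: sum_divide_distrib[symmetric] sum.distrib add_divide_distrib)
        finally have 1: "\<bar>u (p m + z) - u (p 0 + z)\<bar> \<le> \<dots>" .
        have "p m = y" "p 0 = x"
          using m by (simp_all add: p_def v_def)
        moreover have "\<bar>u (y + z) - u y\<bar> \<le> L * r" "\<bar>u (x + z) - u x\<bar> \<le> L * r"
        proof -
          have "norm z \<le> r" "x + z \<in> S" "y + z \<in> S"
            using z r by (auto simp: B_def dist_norm subset_iff)
          then show "\<bar>u (y + z) - u y\<bar> \<le> L * r" "\<bar>u (x + z) - u x\<bar> \<le> L * r"
            using lipschitz_on_normD[OF L _ xy(2), of "y + z"]
              lipschitz_on_normD[OF L _ xy(1), of "x + z"] mult_left_mono[OF _ L0, of "norm z" r]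
            by auto
        qed
        ultimately show ?thesis
          using 1 by (simp add: c_def)
      qed
      have shift_int: "integrable lborel (\<lambda>z. g m (p k + z))" for k
        using g_int[of m] lborel_distr_plus[of "p k"]
          integrable_distr_eq[of "(+) (p k)" lborel borel "g m"] by simp
      have shift: "(\<integral>z. g m (p k + z) \<partial>lborel) = integral\<^sup>L lborel (g m)" for k
        using integral_distr[of "(+) (p k)" lborel borel "g m"] lborel_distr_plus[of "p k"] by simp
      have B_fin: "emeasure lborel B < \<infinity>"
        unfolding B_def by (rule emeasure_lborel_ball_finite)
      have "c * measure lborel B = (\<integral>z. indicator B z * c \<partial>lborel)"
        by (simp add: B_def)
      also have "\<dots> \<le> (\<integral>z. (\<Sum>k<m. g m (p k + z)) / real m \<partial>lborel)"
      proof (rule integral_mono)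
        show "integrable lborel (\<lambda>z. indicator B z * c)"
          using B_fin by (intro integrable_mult_left integrable_real_indicator) (auto simp: B_def)
        show "integrable lborel (\<lambda>z. (\<Sum>k<m. g m (p k + z)) / real m)"
          using shift_int by (intro integrable_divide Bochner_Integration.integrable_sum)
        show "indicator B z * c \<le> (\<Sum>k<m. g m (p k + z)) / real m" for z
          using key[of z] by (auto simp: indicator_def intro!: divide_nonneg_nonneg sum_nonneg g_nonneg)
      qed
      also have "\<dots> = integral\<^sup>L lborel (g m)"
        using m shift_int by (simp add: shift)
      finally show ?thesis .
    qed
    have "c * measure lborel B \<le> 0"
      using le by (intro LIMSEQ_le_const[OF int_lim] exI[of _ 1]) auto
    moreover have "measure lborel B > 0"
      unfolding B_def using content_ball_pos[OF r(1)] by simp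
    ultimately show ?thesis
      by (simp add: c_def mult_le_0_iff)
  qed
  obtain r where r: "r > 0" "ball x r \<subseteq> S" "ball y r \<subseteq> S"
  proof -
    obtain r1 r2 where "r1 > 0" "ball x r1 \<subseteq> S" "r2 > 0" "ball y r2 \<subseteq> S"
      using S(1) xy by (meson open_contains_ball)
    then show thesis
      by (intro that[of "min r1 r2"]) auto
  qed
  have "\<bar>u y - u x\<bar> - K * norm v \<le> 0"
  proof (rule field_le_epsilon)
    fix e :: real assume e: "e > 0"
    define s where "s = min r (e / (2 * L + 1))"
    have s: "s > 0" "s \<le> r" "s \<le> e / (2 * L + 1)"
      using r e L0 by (auto simp: s_def)
    have "\<bar>u y - u x\<bar> - 2 * L * s - K * norm v \<le> 0"
      using r s by (intro small) auto
    moreover have "2 * L * s \<le> (2 * L + 1) * s"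
      using s by simp
    moreover have "(2 * L + 1) * s \<le> e"
      using s L0 by (simp add: field_simps)
    ultimately show "\<bar>u y - u x\<bar> - K * norm v \<le> 0 + e"
      by linarith
  qed
  then show "dist (u x) (u y) \<le> K * dist x y"
    by (simp add: v_def dist_norm norm_minus_commute abs_minus_commute)
qed

section \<open>Smooth approximation of the distance function\<close>

text \<open>
  With \<open>s a x = sqrt (dist x a ^ 2 + k ^ 2)\<close>, the soft minimum \<open>- k * ln (\<Sum>a\<in>Y. exp (- s a x / k))\<close>
  lies between \<open>(MIN a\<in>Y. s a x) - k * ln (card Y)\<close> and \<open>(MIN a\<in>Y. s a x)\<close>, and its gradient is
  a convex combination of the gradients of the \<open>s a\<close>, whose norms are at most \<open>1\<close>.
\<close>

lemma smooth_dist_finite_set: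
  fixes Y :: "'a::euclidean_space set"
  assumes Y: "finite Y" "Y \<noteq> {}" and e: "e > 0"
  obtains f G where "\<And>x. GDERIV f x :> G x" "continuous_on UNIV G" "\<And>x. norm (G x) \<le> 1"
    "\<And>x a. a \<in> Y \<Longrightarrow> f x \<le> dist x a + e" "\<And>x. infdist x Y - e \<le> f x"
proof -
  define N where "N = real (card Y)"
  have N: "N \<ge> 1"
    using Y by (simp add: N_def Suc_le_eq card_gt_0_iff)
  \<comment> \<open>This makes both errors, the smoothing \<open>k\<close> and the soft minimum \<open>k * ln N\<close>, at most \<open>e\<close>.\<close>
  define k where "k = e / (1 + ln N)"
  have k: "k > 0" "k \<le> e" "k * ln N \<le> e"
    using e N by (auto simp: k_def field_simps add_pos_nonneg)
  define s where "s a x = sqrt ((x - a) \<bullet> (x - a) + k\<^sup>2)" for a x :: 'a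
  define W where "W a x = exp (- (s a x / k))" for a x :: 'a
  define Z where "Z x = (\<Sum>a\<in>Y. W a x)" for x :: 'a
  define f where "f x = - (k * ln (Z x))" for x :: 'a
  define G where "G x = (\<Sum>a\<in>Y. (W a x / s a x) *\<^sub>R (x - a)) /\<^sub>R Z x" for x :: 'a
  have rad: "(x - a) \<bullet> (x - a) + k\<^sup>2 > 0" for a x :: 'a
    using k by (simp add: add_nonneg_pos)
  have s_pos: "s a x > 0" for a x
    unfolding s_def using rad by (simp only: real_sqrt_gt_zero)
  have s_ge: "norm (x - a) \<le> s a x" for a x
    unfolding s_def by (rule real_le_rsqrt) (simp add: power2_norm_eq_inner)
  have s_le: "s a x \<le> norm (x - a) + k" for a x
    unfolding s_def using k
    by (intro real_le_lsqrt) (auto simp: power2_sum power2_norm_eq_inner)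
  have W_pos: "W a x > 0" for a x
    by (simp add: W_def)
  have Z_pos: "Z x > 0" for x
    unfolding Z_def using Y W_pos by (intro sum_pos)
  have ds: "(s a has_derivative (\<lambda>h. h \<bullet> (x - a) / s a x)) (at x)" for a x
    unfolding s_def using rad[of x a]
    by (auto intro!: derivative_eq_intros simp: inner_commute field_simps)
  have dW: "(W a has_derivative (\<lambda>h. - (W a x * (h \<bullet> (x - a) / s a x) / k))) (at x)" for a x
    unfolding W_def using k by (auto intro!: derivative_eq_intros ds)
  have dZ: "(Z has_derivative (\<lambda>h. \<Sum>a\<in>Y. - (W a x * (h \<bullet> (x - a) / s a x) / k))) (at x)" for x
    unfolding Z_def by (intro has_derivative_sum dW)
  have df: "GDERIV f x :> G x" for x
  proof -
    have "(f has_derivative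
        (\<lambda>h. - (k * ((\<Sum>a\<in>Y. - (W a x * (h \<bullet> (x - a) / s a x) / k)) * inverse (Z x))))) (at x)"
      unfolding f_def using Z_pos[of x] by (auto intro!: derivative_eq_intros dZ simp: field_simps)
    moreover have "- (k * ((\<Sum>a\<in>Y. - (W a x * (h \<bullet> (x - a) / s a x) / k)) * inverse (Z x)))
        = h \<bullet> G x" for h
    proof -
      have "(\<Sum>a\<in>Y. - (W a x * (h \<bullet> (x - a) / s a x) / k))
          = - ((\<Sum>a\<in>Y. W a x * (h \<bullet> (x - a) / s a x)) / k)"
        by (simp only: sum_negf sum_divide_distrib)
      then show ?thesis
        using k by (simp add: G_def inner_sum_right)
    qed
    ultimately show ?thesis
      by (simp add: gderiv_def)
  qed
  have cs: "continuous_on UNIV (s a)" for a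
    unfolding s_def by (intro continuous_intros)
  have cW: "continuous_on UNIV (W a)" for a
    unfolding W_def using k by (intro continuous_intros cs) auto
  have cG: "continuous_on UNIV G"
    unfolding G_def Z_def using s_pos Z_pos[unfolded Z_def]
    by (intro continuous_intros cW cs) (auto simp: less_imp_neq[THEN not_sym])
  have nG: "norm (G x) \<le> 1" for x
  proof -
    have "norm (\<Sum>a\<in>Y. (W a x / s a x) *\<^sub>R (x - a)) \<le> Z x"
      unfolding Z_def
    proof (rule sum_norm_le)
      fix a
      have "W a x * norm (x - a) \<le> W a x * s a x"
        using W_pos[of a x] s_ge[of x a] by simp
      then show "norm ((W a x / s a x) *\<^sub>R (x - a)) \<le> W a x"
        using W_pos[of a x] s_pos[of a x] by (simp add: pos_divide_le_eq)
    qed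
    then show ?thesis
      using Z_pos[of x] by (simp add: G_def field_simps)
  qed
  have up: "f x \<le> dist x a + e" if a: "a \<in> Y" for x a
  proof -
    have "W a x \<le> Z x"
      unfolding Z_def using Y a W_pos by (intro member_le_sum) (auto simp: less_imp_le)
    then have "ln (W a x) \<le> ln (Z x)"
      using W_pos Z_pos by simp
    then have "- (s a x / k) \<le> ln (Z x)"
      by (simp add: W_def)
    then have "f x \<le> s a x"
      using k by (simp add: f_def field_simps)
    then show ?thesis
      using s_le[of a x] k by (simp add: dist_norm)
  qed
  have lo: "infdist x Y - e \<le> f x" for x
  proof -
    have "Z x \<le> (\<Sum>a\<in>Y. exp (- (infdist x Y / k)))"
      unfolding Z_def
    proof (rule sum_mono)
      fix a assume "a \<in> Y"
      then have "infdist x Y \<le> s a x"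
        using infdist_le[of a Y x] s_ge[of x a] by (simp add: dist_norm)
      then show "W a x \<le> exp (- (infdist x Y / k))"
        using k by (simp add: W_def divide_right_mono)
    qed
    then have "Z x \<le> N * exp (- (infdist x Y / k))"
      by (simp add: N_def)
    then have "ln (Z x) \<le> ln (N * exp (- (infdist x Y / k)))"
      using Z_pos N by simp
    also have "\<dots> = ln N - infdist x Y / k"
      using N by (simp add: ln_mult)
    finally have "k * ln (Z x) \<le> k * (ln N - infdist x Y / k)"
      using k by simp
    then show ?thesis
      using k by (simp add: f_def right_diff_distrib)
  qed
  show thesis
    using that[OF df cG nG up lo] .
qed

text \<open>
  A \<open>C\<^sup>1\<close> substitute for the positive part. Composing with the positive part itself could destroy
  differentiability on the zero set. On the positive axis
  \<open>t\<^sup>2 / (t + k) = t - k + k\<^sup>2 / (t + k)\<close>, which gives both the slope bound and the lower bound.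
\<close>

lemma smooth_cutoff:
  fixes k :: real
  assumes k: "k > 0"
  obtains \<phi> \<phi>' where "\<And>t. DERIV \<phi> t :> \<phi>' t" "continuous_on UNIV \<phi>'" "\<And>t. \<bar>\<phi>' t\<bar> \<le> 1"
    "\<And>t. t \<le> 0 \<Longrightarrow> \<phi> t = 0" "\<And>t. t - k \<le> \<phi> t"
proof -
  define \<phi> where "\<phi> t = (max 0 t)\<^sup>2 / (max 0 t + k)" for t
  define \<phi>' where "\<phi>' t = 1 - k\<^sup>2 / (max 0 t + k)\<^sup>2" for t
  have d: "DERIV \<phi> t :> \<phi>' t" for t
  proof -
    consider "t < 0" | "t = 0" | "t > 0"
      by linarith
    then show ?thesis
    proof cases
      case 1
      have "DERIV (\<lambda>t. 0) t :> \<phi>' t"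
        using 1 k by (simp add: \<phi>'_def)
      moreover have "eventually (\<lambda>s. s < 0) (nhds t)"
        using 1 by (intro eventually_nhds_in_open[of "{..<0}", simplified]) auto
      ultimately show ?thesis
        by (subst DERIV_cong_ev[OF refl _ refl, of _ "\<lambda>t. 0"]) (auto elim!: eventually_mono simp: \<phi>_def)
    next
      case 2
      have "((\<lambda>h. \<phi> h / h) \<longlongrightarrow> 0) (at 0)"
      proof (rule Lim_null_comparison)
        show "((\<lambda>h. \<bar>h\<bar> / k) \<longlongrightarrow> 0) (at 0)"
          using k by (auto intro!: tendsto_eq_intros)
        show "eventually (\<lambda>h. norm (\<phi> h / h) \<le> \<bar>h\<bar> / k) (at 0)"
        proof (rule always_eventually, rule allI)
          fix h :: real
          show "norm (\<phi> h / h) \<le> \<bar>h\<bar> / k"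
          proof (cases "h \<le> 0")
            case True
            then show ?thesis
              using k by (simp add: \<phi>_def divide_nonpos_pos)
          next
            case False
            then have "\<phi> h / h = h / (h + k)"
              by (simp add: \<phi>_def power2_eq_square)
            moreover have "h / (h + k) \<le> h / k"
              using False k by (intro divide_left_mono) auto
            ultimately show ?thesis
              using False k by simp
          qed
        qed
      qed
      then show ?thesis
        using 2 k by (simp add: DERIV_def \<phi>'_def) (simp add: \<phi>_def)
    next
      case 3
      have "\<phi>' t = ((t + k)\<^sup>2 - k\<^sup>2) / (t + k)\<^sup>2"
        using 3 k by (simp add: \<phi>'_def diff_divide_distrib)
      then have "DERIV (\<lambda>t. t\<^sup>2 / (t + k)) t :> \<phi>' t"
        using 3 k by (auto intro!: derivative_eq_intros simp: power2_eq_square algebra_simps)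
      moreover have "eventually (\<lambda>s. s > 0) (nhds t)"
        using 3 by (intro eventually_nhds_in_open[of "{0<..}", simplified]) auto
      ultimately show ?thesis
        by (subst DERIV_cong_ev[OF refl _ refl, of _ "\<lambda>t. t\<^sup>2 / (t + k)"])
          (auto elim!: eventually_mono simp: \<phi>_def)
    qed
  qed
  have c: "continuous_on UNIV \<phi>'"
    unfolding \<phi>'_def using k by (intro continuous_intros) (auto simp: max_def add_pos_pos less_imp_neq[THEN not_sym])
  have b: "\<bar>\<phi>' t\<bar> \<le> 1" for t
  proof -
    have "k\<^sup>2 \<le> (max 0 t + k)\<^sup>2"
      using k by (intro power_mono) auto
    then have "k\<^sup>2 / (max 0 t + k)\<^sup>2 \<le> 1"
      by (auto simp: divide_le_eq_1)
    moreover have "k\<^sup>2 / (max 0 t + k)\<^sup>2 \<ge> 0"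
      by simp
    ultimately show ?thesis
      unfolding \<phi>'_def by linarith
  qed
  have l: "t - k \<le> \<phi> t" for t
  proof (cases "t \<le> 0")
    case True
    then show ?thesis
      using k by (simp add: \<phi>_def)
  next
    case False
    have "(t - k) * (t + k) \<le> t\<^sup>2"
      by (simp add: algebra_simps power2_eq_square)
    then show ?thesis
      using False k by (simp add: \<phi>_def pos_le_divide_eq)
  qed
  show thesis
    using that[OF d c b _ l] by (simp add: \<phi>_def)
qed

text \<open>
  The soft minimum over a net of \<open>S\<close> is small on \<open>S\<close> but need not vanish there. Subtracting its
  bound on \<open>S\<close> before the cutoff makes it exactly \<open>0\<close> on \<open>S\<close>.
\<close>

lemma smooth_approx_infdist:
  fixes S :: "'a::euclidean_space set"
  assumes S: "compact S" "S \<noteq> {}" and e: "e > 0"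
  obtains w G where "\<And>x. GDERIV w x :> G x" "continuous_on UNIV G" "\<And>x. norm (G x) \<le> 1"
    "\<And>x. x \<in> S \<Longrightarrow> w x = 0" "\<And>x. infdist x S - e \<le> w x"
proof -
  \<comment> \<open>Losses of \<open>c\<close> each in the lower bound of the soft minimum and in the cutoff, and of \<open>2 * c\<close>
    in the subtraction.\<close>
  define c where "c = e / 4"
  have c: "c > 0"
    using e by (simp add: c_def)
  obtain Y where Y: "finite Y" "Y \<subseteq> S" "S \<subseteq> (\<Union>y\<in>Y. ball y c)"
    using seq_compact_imp_totally_bounded[OF compact_imp_seq_compact[OF S(1)], rule_format, OF c] by auto
  have Yne: "Y \<noteq> {}"
    using Y S by auto
  obtain f G where f: "\<And>x. GDERIV f x :> G x" "continuous_on UNIV G" "\<And>x. norm (G x) \<le> 1"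
    "\<And>x a. a \<in> Y \<Longrightarrow> f x \<le> dist x a + c" "\<And>x. infdist x Y - c \<le> f x"
    using smooth_dist_finite_set[OF Y(1) Yne c] by metis
  obtain \<phi> \<phi>' where p: "\<And>t. DERIV \<phi> t :> \<phi>' t" "continuous_on UNIV \<phi>'" "\<And>t. \<bar>\<phi>' t\<bar> \<le> 1"
    "\<And>t. t \<le> 0 \<Longrightarrow> \<phi> t = 0" "\<And>t. t - c \<le> \<phi> t"
    using smooth_cutoff[OF c] by metis
  define w where "w x = \<phi> (f x - 2 * c)" for x
  define H where "H x = \<phi>' (f x - 2 * c) *\<^sub>R G x" for x
  have d: "GDERIV w x :> H x" for x
  proof -
    have "((\<lambda>x. f x - 2 * c) has_derivative (\<lambda>h. h \<bullet> G x)) (at x)"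
      using f(1)[of x] by (auto simp: gderiv_def intro!: derivative_eq_intros)
    from has_derivative_compose[OF this p(1)[of "f x - 2 * c", unfolded has_field_derivative_def]]
    show ?thesis
      by (simp add: gderiv_def w_def[abs_def] H_def)
  qed
  have cf: "continuous_on UNIV f"
    using f(1) unfolding gderiv_def
    by (intro continuous_at_imp_continuous_on ballI) (rule has_derivative_continuous)
  have cH: "continuous_on UNIV H"
    unfolding H_def by (intro continuous_intros continuous_on_compose2[OF p(2)] cf f(2)) auto
  have nH: "norm (H x) \<le> 1" for x
    using mult_mono[OF p(3)[of "f x - 2 * c"] f(3)[of x]] by (simp add: H_def)
  have z: "w x = 0" if x: "x \<in> S" for x
  proof -
    obtain a where "a \<in> Y" "dist x a < c"
      using Y(3) x by (auto simp: dist_commute)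
    then have "f x \<le> 2 * c"
      using f(4)[of a x] by simp
    then show ?thesis
      by (simp add: w_def p(4))
  qed
  have l: "infdist x S - e \<le> w x" for x
    using f(5)[of x] p(5)[of "f x - 2 * c"] infdist_mono[OF Y(2) Yne, of x]
    by (simp add: w_def c_def)
  show thesis
    using that[OF d cH nH z l] .
qed

lemma lipschitz_on_of_gradient_le:
  fixes w :: "'a::euclidean_space \<Rightarrow> real"
  assumes "\<And>x. GDERIV w x :> G x" "\<And>x. norm (G x) \<le> K"
  shows "K-lipschitz_on UNIV w"
proof (rule lipschitz_onI)
  show "K \<ge> 0"
    using norm_ge_zero assms(2) by (rule order_trans)
  have "onorm (\<lambda>h. h \<bullet> G x) \<le> K" for x
  proof (rule onorm_le)
    fix h
    have "norm (h \<bullet> G x) \<le> norm h * norm (G x)"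
      by (simp add: Cauchy_Schwarz_ineq2)
    also have "\<dots> \<le> norm h * K"
      by (intro mult_left_mono assms(2)) simp
    finally show "norm (h \<bullet> G x) \<le> K * norm h"
      by (simp add: mult.commute)
  qed
  then show "dist (w x) (w y) \<le> K * dist x y" for x y
    unfolding dist_norm using assms(1)
    by (intro differentiable_bound[of UNIV w "\<lambda>x h. h \<bullet> G x"]) (auto simp: gderiv_def)
qed

section \<open>The gradient constraint on a domain\<close>

lemma grad_Linf_le:
  assumes "\<And>x. GDERIV w x :> G x" "continuous_on UNIV G" "\<And>x. norm (G x) \<le> K"
  shows "grad_Linf \<Omega> w \<le> ereal K"
proof -
  have eq: "(if \<exists>D. GDERIV w x :> D then ereal (norm (grad w x)) else \<infinity>) = ereal (norm (G x))" for x
    using assms(1)[of x] by (auto simp: grad_eq)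
  have "(\<lambda>x. ereal (norm (G x))) \<in> borel_measurable borel"
    using borel_measurable_continuous_onI[OF assms(2)] by measurable
  then have "(\<lambda>x. ereal (norm (G x))) \<in> borel_measurable (lebesgue_on \<Omega>)"
    by (intro measurable_restrict_space1 measurable_completion) simp
  then show ?thesis
    unfolding grad_Linf_def eq by (rule esssup_I) (simp add: assms(3))
qed

lemma AE_gradient_le_of_grad_Linf:
  assumes "open \<Omega>" "grad_Linf \<Omega> u \<le> ereal K"
  shows "AE x in lborel. x \<in> \<Omega> \<longrightarrow> (\<exists>D. GDERIV u x :> D \<and> norm D \<le> K)"
proof -
  let ?f = "\<lambda>x. if \<exists>D. GDERIV u x :> D then ereal (norm (grad u x)) else \<infinity>"
  have "AE x in lebesgue_on \<Omega>. ?f x \<le> grad_Linf \<Omega> u"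
    unfolding grad_Linf_def by (rule esssup_AE)
  then have "AE x in lebesgue_on \<Omega>. \<exists>D. GDERIV u x :> D \<and> norm D \<le> K"
  proof eventually_elim
    case (elim x)
    then have "?f x \<le> ereal K"
      using assms(2) by (rule order_trans)
    then obtain D where "GDERIV u x :> D" "ereal (norm (grad u x)) \<le> ereal K"
      by (auto split: if_splits)
    then show ?case
      by (auto simp: grad_eq)
  qed
  then have "AE x in lebesgue. x \<in> \<Omega> \<longrightarrow> (\<exists>D. GDERIV u x :> D \<and> norm D \<le> K)"
    using assms(1) by (simp add: AE_restrict_space_iff)
  then show ?thesis
    by (simp add: AE_completion_iff)
qed

lemma infdist_in_Lip_closure: "(\<lambda>x. infdist x A) \<in> Lip_closure \<Omega>"
proof -
  have "1-lipschitz_on (closure \<Omega>) (\<lambda>x. infdist x A)"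
    by (rule lipschitz_onI) (simp_all add: dist_real_def infdist_triangle_abs)
  then show ?thesis
    unfolding Lip_closure_def by blast
qed

lemma ball_infdist_frontier_subset:
  fixes x :: "'a::euclidean_space"
  assumes "x \<in> \<Omega>"
  shows "ball x (infdist x (frontier \<Omega>)) \<subseteq> \<Omega>"
proof (rule ccontr)
  assume not_sub: "\<not> ?thesis"
  then have "ball x (infdist x (frontier \<Omega>)) \<noteq> {}"
    by (metis empty_subsetI)
  then have "infdist x (frontier \<Omega>) > 0"
    by (simp only: ball_eq_empty not_le)
  then have "x \<in> ball x (infdist x (frontier \<Omega>)) \<inter> \<Omega>"
    using assms by simp
  then have "ball x (infdist x (frontier \<Omega>)) \<inter> frontier \<Omega> \<noteq> {}"
    using not_sub by (intro connected_Int_frontier connected_ball; blast)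
  then show False
    using infdist_le[of _ "frontier \<Omega>" x] by fastforce
qed

lemma infdist_frontier_pos:
  fixes x :: "'a::euclidean_space"
  assumes "open \<Omega>" "x \<in> \<Omega>" "frontier \<Omega> \<noteq> {}"
  shows "infdist x (frontier \<Omega>) > 0"
proof -
  have "x \<notin> frontier \<Omega>"
    using assms by (simp add: frontier_def interior_open)
  then show ?thesis
    using assms(3) infdist_pos_not_in_closed[OF frontier_closed] by blast
qed

text \<open>
  The closed ball touches the boundary at the points nearest to \<open>x\<close>; continuity on the closure of
  \<open>\<Omega>\<close> carries the slope bound from the open ball to these points.
\<close>

lemma Lip_closure_lipschitz_on_cball:
  assumes \<Omega>: "open \<Omega>" "frontier \<Omega> \<noteq> {}" and x: "x \<in> \<Omega>"
    and u: "u \<in> Lip_closure \<Omega>" "grad_Linf \<Omega> u \<le> 1"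
  shows "1-lipschitz_on (cball x (infdist x (frontier \<Omega>))) u"
proof -
  let ?B = "ball x (infdist x (frontier \<Omega>))"
  have sub: "?B \<subseteq> \<Omega>"
    using x by (rule ball_infdist_frontier_subset)
  have cl: "closure ?B = cball x (infdist x (frontier \<Omega>))"
    using infdist_frontier_pos[OF \<Omega>(1) x \<Omega>(2)] by simp
  obtain L where L: "L-lipschitz_on (closure \<Omega>) u"
    using u(1) by (auto simp: Lip_closure_def)
  have "AE w in lborel. w \<in> \<Omega> \<longrightarrow> (\<exists>D. GDERIV u w :> D \<and> norm D \<le> 1)"
    using AE_gradient_le_of_grad_Linf[OF \<Omega>(1), of u 1] u(2) by (simp add: one_ereal_def)
  then have AE: "AE w in lborel. w \<in> ?B \<longrightarrow> (\<exists>D. GDERIV u w :> D \<and> norm D \<le> 1)"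
    by eventually_elim (use sub in auto)
  have "L-lipschitz_on ?B u"
    using L by (rule lipschitz_on_subset) (use sub closure_subset[of \<Omega>] in blast)
  then have "1-lipschitz_on ?B u"
    by (rule lipschitz_on_of_AE_gradient_le[OF open_ball convex_ball bounded_ball _ zero_le_one AE])
  moreover have "continuous_on (closure ?B) u"
    using lipschitz_on_continuous_on[OF L] closure_mono[OF sub] by (rule continuous_on_subset)
  ultimately show ?thesis
    unfolding cl[symmetric] by (rule lipschitz_on_closure)
qed

section \<open>Probability measures on subsets of the closure\<close>

lemma space_borel_probs:
  assumes "M \<in> borel_probs S"
  shows "space M = S"
  using assms sets_eq_imp_space_eq[of M "restrict_space borel S"]
  by (simp add: borel_probs_def space_restrict_space)

lemma Lip_closure_integral:
  assumes M: "M \<in> borel_probs S" "S \<subseteq> closure \<Omega>" and \<Omega>: "bounded \<Omega>" and u: "u \<in> Lip_closure \<Omega>"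
  shows "integrable M u" "(\<integral>x. u x \<partial>on_closure \<Omega> M) = (\<integral>x. u x \<partial>M)"
proof -
  interpret prob_space M
    using M(1) by (simp add: borel_probs_def)
  obtain L where "L-lipschitz_on (closure \<Omega>) u"
    using u by (auto simp: Lip_closure_def)
  then have cont: "continuous_on (closure \<Omega>) u"
    by (rule lipschitz_on_continuous_on)
  then have u_meas: "u \<in> borel_measurable (restrict_space borel (closure \<Omega>))"
    by (rule borel_measurable_continuous_on_restrict)
  have "(\<lambda>x. x) \<in> restrict_space borel S \<rightarrow>\<^sub>M restrict_space borel (closure \<Omega>)"
    using M(2) by (intro measurable_restrict_space3) auto
  then have id_meas: "(\<lambda>x. x) \<in> M \<rightarrow>\<^sub>M restrict_space borel (closure \<Omega>)"
    using M(1) by (simp add: borel_probs_def cong: measurable_cong_sets)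
  have "bounded (u ` closure \<Omega>)"
    using cont \<Omega> by (intro compact_imp_bounded compact_continuous_image) (simp_all add: compact_closure)
  then obtain C where "\<forall>x\<in>closure \<Omega>. norm (u x) \<le> C"
    by (auto simp: bounded_iff)
  then have "AE x in M. norm (u x) \<le> C"
    using M(2) space_borel_probs[OF M(1)] by (intro AE_I2) auto
  then show "integrable M u"
    using measurable_compose[OF id_meas u_meas] by (rule integrable_const_bound)
  show "(\<integral>x. u x \<partial>on_closure \<Omega> M) = (\<integral>x. u x \<partial>M)"
    unfolding on_closure_def using id_meas u_meas by (rule integral_distr)
qed

section \<open>Transport to the boundary\<close>

text \<open>
  A nearest boundary point need not be unique, and choosing one separately for each \<open>x\<close> need not be
  measurable. So \<open>x\<close> is rounded first: it is replaced by the first point \<open>z\<close> of a countable dense set that is close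
  enough, and \<open>P x\<close> is a nearest point to \<open>z\<close>. Then \<open>P\<close> factors through a discrete countable space,
  so that any choice of nearest points is measurable. Requiring \<open>dist x z < infdist x (frontier \<Omega>)\<close>
  keeps the segment from \<open>x\<close> to \<open>z\<close> inside \<open>\<Omega>\<close>.
\<close>

lemma almost_nearest_point_map:
  fixes \<Omega> :: "'a::euclidean_space set"
  assumes \<Omega>: "open \<Omega>" "frontier \<Omega> \<noteq> {}" and e: "e > 0"
  obtains P where "P \<in> restrict_space borel \<Omega> \<rightarrow>\<^sub>M restrict_space borel (frontier \<Omega>)"
    "\<And>x. x \<in> \<Omega> \<Longrightarrow> \<exists>z. dist x z < e \<and> dist x z < infdist x (frontier \<Omega>) \<and>
       P x \<in> frontier \<Omega> \<and> dist z (P x) = infdist z (frontier \<Omega>)"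
proof -
  let ?F = "frontier \<Omega>"
  obtain D :: "'a set" where D: "countable D" "\<And>X. open X \<Longrightarrow> X \<noteq> {} \<Longrightarrow> \<exists>d\<in>D. d \<in> X"
    by (rule countable_dense_setE) blast
  have Dne: "D \<noteq> {}"
    using D(2)[of UNIV] by auto
  define z where "z = from_nat_into D"
  have "\<forall>w. \<exists>y\<in>?F. infdist w ?F = dist w y"
    using infdist_attains_inf[OF frontier_closed \<Omega>(2)] by metis
  then obtain y where y: "\<And>w. y w \<in> ?F" "\<And>w. dist w (y w) = infdist w ?F"
    by metis
  define Q where "Q x k \<longleftrightarrow> dist x (z k) < e \<and> dist x (z k) < infdist x ?F" for x k
  define P where "P x = y (z (LEAST k. Q x k))" for x
  have ex: "\<exists>k. Q x k" if x: "x \<in> \<Omega>" for x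
  proof -
    have "min e (infdist x ?F) > 0"
      using e infdist_frontier_pos[OF \<Omega>(1) x \<Omega>(2)] by simp
    then have "ball x (min e (infdist x ?F)) \<noteq> {}"
      by (simp only: ball_eq_empty not_le)
    then obtain d where "d \<in> D" "d \<in> ball x (min e (infdist x ?F))"
      using D(2)[OF open_ball] by metis
    moreover have "range z = D"
      unfolding z_def using Dne D(1) by (rule range_from_nat_into)
    ultimately show ?thesis
      by (auto simp: Q_def)
  qed
  have [measurable]: "(\<lambda>x. infdist x ?F) \<in> borel_measurable borel"
    by (intro borel_measurable_continuous_onI continuous_intros)
  have "Measurable.pred borel (\<lambda>x. Q x k)" for k
    unfolding Q_def by measurable
  then have "(\<lambda>x. LEAST k. Q x k) \<in> restrict_space borel \<Omega> \<rightarrow>\<^sub>M count_space UNIV"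
    by (intro measurable_Least measurable_restrict_space1)
  then have "(\<lambda>x. y (z (LEAST k. Q x k))) \<in> restrict_space borel \<Omega> \<rightarrow>\<^sub>M restrict_space borel ?F"
    by (rule measurable_compose) (simp add: space_restrict_space y(1))
  then have 1: "P \<in> restrict_space borel \<Omega> \<rightarrow>\<^sub>M restrict_space borel ?F"
    by (simp add: P_def[abs_def])
  have 2: "\<exists>z. dist x z < e \<and> dist x z < infdist x ?F \<and> P x \<in> ?F \<and> dist z (P x) = infdist z ?F"
    if x: "x \<in> \<Omega>" for x
  proof -
    have "Q x (LEAST k. Q x k)"
      using ex[OF x] by (rule LeastI_ex)
    then show ?thesis
      using y by (auto simp: P_def Q_def)
  qed
  show thesis
    using that[OF 1 2] .
qed

text \<open>
  For an admissible \<open>u\<close> and the intermediate point \<open>z\<close> between \<open>x\<close> and \<open>P x\<close>, the slope bound in the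
  two balls around \<open>x\<close> and \<open>z\<close> gives
  \<open>u x - u (P x) \<le> dist x z + infdist z (frontier \<Omega>) \<le> infdist x (frontier \<Omega>) + 2 * dist x z\<close>,
  uniformly in \<open>u\<close>.
\<close>

lemma ex_boundary_prob_W1_le:
  fixes \<Omega> :: "'a::euclidean_space set"
  assumes \<Omega>: "open \<Omega>" "bounded \<Omega>" "frontier \<Omega> \<noteq> {}" and \<mu>: "\<mu> \<in> borel_probs \<Omega>" and e: "e > 0"
  shows "\<exists>\<delta>\<in>borel_probs (frontier \<Omega>).
    W1 \<Omega> (on_closure \<Omega> \<mu>) (on_closure \<Omega> \<delta>) \<le> ereal ((\<integral>x. infdist x (frontier \<Omega>) \<partial>\<mu>) + e)"
proof -
  let ?F = "frontier \<Omega>"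
  interpret prob_space \<mu>
    using \<mu> by (simp add: borel_probs_def)
  have F_sub: "?F \<subseteq> closure \<Omega>"
    by (simp add: frontier_def)
  have space: "space \<mu> = \<Omega>"
    using \<mu> by (rule space_borel_probs)
  obtain P where P: "P \<in> restrict_space borel \<Omega> \<rightarrow>\<^sub>M restrict_space borel ?F"
    "\<And>x. x \<in> \<Omega> \<Longrightarrow> \<exists>z. dist x z < e / 2 \<and> dist x z < infdist x ?F \<and> P x \<in> ?F \<and> dist z (P x) = infdist z ?F"
    using almost_nearest_point_map[OF \<Omega>(1,3) half_gt_zero[OF e]] by metis
  have P_meas: "P \<in> \<mu> \<rightarrow>\<^sub>M restrict_space borel ?F"
    using P(1) \<mu> by (simp add: borel_probs_def cong: measurable_cong_sets)
  define \<delta> where "\<delta> = distr \<mu> (restrict_space borel ?F) P"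
  have \<delta>: "\<delta> \<in> borel_probs ?F"
    using prob_space_distr[OF P_meas] by (simp add: borel_probs_def \<delta>_def)
  have "W1 \<Omega> (on_closure \<Omega> \<mu>) (on_closure \<Omega> \<delta>) \<le> ereal ((\<integral>x. infdist x ?F \<partial>\<mu>) + e)"
    unfolding W1_def
  proof (rule SUP_least)
    fix u assume "u \<in> {u \<in> Lip_closure \<Omega>. grad_Linf \<Omega> u \<le> 1}"
    then have u: "u \<in> Lip_closure \<Omega>" "grad_Linf \<Omega> u \<le> 1"
      by auto
    note u\<mu> = Lip_closure_integral[OF \<mu> closure_subset \<Omega>(2) u(1)]
    note u\<delta> = Lip_closure_integral[OF \<delta> F_sub \<Omega>(2) u(1)]
    have u_meas: "u \<in> borel_measurable (restrict_space borel ?F)"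
      using borel_measurable_integrable[OF u\<delta>(1)] by (simp add: \<delta>_def)
    have uP: "integrable \<mu> (\<lambda>x. u (P x))" "(\<integral>x. u x \<partial>\<delta>) = (\<integral>x. u (P x) \<partial>\<mu>)"
      using u\<delta>(1) integrable_distr_eq[OF P_meas u_meas] integral_distr[OF P_meas u_meas]
      by (simp_all add: \<delta>_def)
    have dist_int: "integrable \<mu> (\<lambda>x. infdist x ?F)"
      using Lip_closure_integral(1)[OF \<mu> closure_subset \<Omega>(2) infdist_in_Lip_closure] .
    have "u x - u (P x) \<le> infdist x ?F + e" if x: "x \<in> \<Omega>" for x
    proof -
      obtain z where z: "dist x z < e / 2" "dist x z < infdist x ?F" "P x \<in> ?F"
        "dist z (P x) = infdist z ?F"
        using P(2)[OF x] by blast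
      have "z \<in> \<Omega>"
        using ball_infdist_frontier_subset[OF x] z(2) by auto
      have "u x - u z \<le> dist x z"
        using lipschitz_onD[OF Lip_closure_lipschitz_on_cball[OF \<Omega>(1,3) x u], of x z] z(2)
        by (simp add: dist_real_def infdist_nonneg)
      moreover have "u z - u (P x) \<le> infdist z ?F"
        using lipschitz_onD[OF Lip_closure_lipschitz_on_cball[OF \<Omega>(1,3) \<open>z \<in> \<Omega>\<close> u], of z "P x"] z(4)
        by (simp add: dist_real_def infdist_nonneg)
      moreover have "infdist z ?F \<le> infdist x ?F + dist z x"
        by (rule infdist_triangle)
      ultimately show ?thesis
        using z(1) by (simp add: dist_commute)
    qed
    then have "(\<integral>x. u x - u (P x) \<partial>\<mu>) \<le> (\<integral>x. infdist x ?F + e \<partial>\<mu>)"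
      using u\<mu>(1) uP(1) dist_int by (intro integral_mono) (auto simp: space)
    then show "ereal ((\<integral>x. u x \<partial>on_closure \<Omega> \<mu>) - (\<integral>x. u x \<partial>on_closure \<Omega> \<delta>))
        \<le> ereal ((\<integral>x. infdist x ?F \<partial>\<mu>) + e)"
      using u\<mu> uP dist_int by (simp add: u\<delta>(2) prob_space)
  qed
  with \<delta> show ?thesis
    by blast
qed

lemma integral_infdist_frontier_le_J_star:
  fixes \<Omega> :: "'a::euclidean_space set"
  assumes \<Omega>: "bounded \<Omega>" "frontier \<Omega> \<noteq> {}" and \<mu>: "\<mu> \<in> borel_probs \<Omega>"
  shows "ereal (\<integral>x. infdist x (frontier \<Omega>) \<partial>\<mu>) \<le> J_star \<Omega> \<mu>"
proof (rule ereal_le_epsilon2)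
  fix e :: real assume e: "e > 0"
  let ?F = "frontier \<Omega>"
  interpret prob_space \<mu>
    using \<mu> by (simp add: borel_probs_def)
  have "compact ?F"
    using \<Omega>(1) by (rule compact_frontier_bounded)
  then obtain w G where w: "\<And>x. GDERIV w x :> G x" "continuous_on UNIV G" "\<And>x. norm (G x) \<le> 1"
    "\<And>x. x \<in> ?F \<Longrightarrow> w x = 0" "\<And>x. infdist x ?F - e \<le> w x"
    using smooth_approx_infdist[OF _ \<Omega>(2) e] by metis
  have "1-lipschitz_on (closure \<Omega>) w"
    using lipschitz_on_of_gradient_le[OF w(1,3)] by (rule lipschitz_on_subset) simp
  then have w_Lip: "w \<in> Lip_closure \<Omega>"
    by (auto simp: Lip_closure_def)
  have "grad_Linf \<Omega> w \<le> 1"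
    using grad_Linf_le[OF w(1-3), of \<Omega>] by (simp add: one_ereal_def)
  then have w_adm: "w \<in> {u \<in> Lip_zero \<Omega>. grad_Linf \<Omega> u \<le> 1}"
    using w_Lip w(4) by (simp add: Lip_zero_def)
  note int = Lip_closure_integral(1)[OF \<mu> closure_subset \<Omega>(1)]
  have "(\<integral>x. infdist x ?F \<partial>\<mu>) \<le> (\<integral>x. w x + e \<partial>\<mu>)"
    using int[OF w_Lip] int[OF infdist_in_Lip_closure] w(5) by (intro integral_mono) (auto simp: diff_le_eq)
  also have "\<dots> = (\<integral>x. w x \<partial>\<mu>) + e"
    using int[OF w_Lip] by (simp add: prob_space)
  finally have "ereal (\<integral>x. infdist x ?F \<partial>\<mu>) \<le> ereal (\<integral>x. w x \<partial>\<mu>) + ereal e"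
    by simp
  also have "ereal (\<integral>x. w x \<partial>\<mu>) \<le> J_star \<Omega> \<mu>"
    unfolding J_star_def using w_adm by (rule SUP_upper)
  finally show "ereal (\<integral>x. infdist x ?F \<partial>\<mu>) \<le> J_star \<Omega> \<mu> + ereal e"
    by (simp add: add_right_mono)
qed

lemma J_star_le_W1:
  fixes \<Omega> :: "'a::euclidean_space set"
  assumes "bounded \<Omega>" "\<mu> \<in> borel_probs \<Omega>" "\<delta> \<in> borel_probs (frontier \<Omega>)"
  shows "J_star \<Omega> \<mu> \<le> W1 \<Omega> (on_closure \<Omega> \<mu>) (on_closure \<Omega> \<delta>)"
  unfolding J_star_def
proof (rule SUP_least)
  fix u assume u: "u \<in> {u \<in> Lip_zero \<Omega>. grad_Linf \<Omega> u \<le> 1}"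
  then have u_Lip: "u \<in> Lip_closure \<Omega>"
    by (simp add: Lip_zero_def)
  have "(\<integral>x. u x \<partial>\<delta>) = (\<integral>x. 0 \<partial>\<delta>)"
    using u space_borel_probs[OF assms(3)]
    by (intro Bochner_Integration.integral_cong) (auto simp: Lip_zero_def)
  moreover have "frontier \<Omega> \<subseteq> closure \<Omega>"
    by (simp add: frontier_def)
  ultimately have "(\<integral>x. u x \<partial>\<mu>) = (\<integral>x. u x \<partial>on_closure \<Omega> \<mu>) - (\<integral>x. u x \<partial>on_closure \<Omega> \<delta>)"
    using Lip_closure_integral(2)[OF assms(2) closure_subset assms(1) u_Lip]
      Lip_closure_integral(2)[OF assms(3) _ assms(1) u_Lip] by simp
  then show "ereal (\<integral>x. u x \<partial>\<mu>) \<le> W1 \<Omega> (on_closure \<Omega> \<mu>) (on_closure \<Omega> \<delta>)"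
    unfolding W1_def using u u_Lip by (auto intro!: SUP_upper)
qed

theorem proposition4p1:
  fixes \<Omega> :: "(real ^ 'n) set" and \<mu> :: "(real ^ 'n) measure"
  assumes "bounded_domain \<Omega>"
    and "\<mu> \<in> borel_probs \<Omega>"
  shows "J_star \<Omega> \<mu> =
    (INF \<delta> \<in> borel_probs (frontier \<Omega>). W1 \<Omega> (on_closure \<Omega> \<mu>) (on_closure \<Omega> \<delta>))"
proof (rule antisym)
  have \<Omega>: "open \<Omega>" "bounded \<Omega>" "\<Omega> \<noteq> {}"
    using assms(1) by (auto simp: bounded_domain_def)
  have F: "frontier \<Omega> \<noteq> {}"
    using \<Omega> by (intro frontier_not_empty) auto
  show "J_star \<Omega> \<mu> \<le> (INF \<delta> \<in> borel_probs (frontier \<Omega>). W1 \<Omega> (on_closure \<Omega> \<mu>) (on_closure \<Omega> \<delta>))"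
    by (intro INF_greatest J_star_le_W1 \<Omega> assms(2))
  have "(INF \<delta> \<in> borel_probs (frontier \<Omega>). W1 \<Omega> (on_closure \<Omega> \<mu>) (on_closure \<Omega> \<delta>))
      \<le> ereal (\<integral>x. infdist x (frontier \<Omega>) \<partial>\<mu>)"
  proof (rule ereal_le_epsilon2)
    fix e :: real assume "e > 0"
    from ex_boundary_prob_W1_le[OF \<Omega>(1,2) F assms(2) this]
    show "(INF \<delta> \<in> borel_probs (frontier \<Omega>). W1 \<Omega> (on_closure \<Omega> \<mu>) (on_closure \<Omega> \<delta>))
        \<le> ereal (\<integral>x. infdist x (frontier \<Omega>) \<partial>\<mu>) + ereal e"
      by (auto intro: INF_lower2)
  qed
  also have "\<dots> \<le> J_star \<Omega> \<mu>"
    using \<Omega>(2) F assms(2) by (rule integral_infdist_frontier_le_J_star)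
  finally show "(INF \<delta> \<in> borel_probs (frontier \<Omega>). W1 \<Omega> (on_closure \<Omega> \<mu>) (on_closure \<Omega> \<delta>))
      \<le> J_star \<Omega> \<mu>" .
qed

end
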